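(* Let $\alpha,\gamma,\kappa>-1$ be real numbers with $\alpha+\kappa>-\frac32$. For all $n,k\in\mathbb{N}_0$, \[ s_{n,k}^{\alpha,\gamma,\kappa}(x,y)=p_{n,k}^{\alpha,\gamma,\kappa}(x,y), \] where $p_{n,k}^{\alpha,\gamma,\kappa}$ is the monic symmetric orthogonal basis associated with $w_{\alpha,\gamma,\kappa}$ and \[ s_{n,k}^{\alpha,\gamma,\kappa}(x,y)=c_{n,k}^{\alpha,\gamma,\kappa}\,(x+y)^{2k}P_n^{(2\alpha+2\kappa+4k+2,\gamma)}(1-2x-2y)\,P_k^{(\kappa,\alpha)}\left(1-2\frac{(x-y)^2}{(x+y)^2}\right), \] \[ c_{n,k}^{\alpha,\gamma,\kappa}=\frac{(-1)^n\,n!\,k!}{4^k\,(n+2\alpha+2\kappa+4k+\gamma+3)_n\,(k+\alpha+\kappa+1)_k}. \]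
   Context: All polynomials have real coefficients; symmetric means invariant under interchange of $x$ and $y$. $\mathbb{N}_0$ is the set of nonnegative integers and $(a)_0=1$, $(a)_j=a(a+1)\cdots(a+j-1)$ is the Pochhammer symbol. Let $\mathbf{T}^2=\{(x,y)\in\mathbb{R}^2:\ x\ge0,\ y\ge0,\ x+y\le1\}$, $\triangle=\{(x,y)\in\mathbf{T}^2:\ y<x\}$, and \[ w_{\alpha,\gamma,\kappa}(x,y)=(xy)^{\alpha}(1-x-y)^{\gamma}|x-y|^{2\kappa+1}. \] For $a,b>-1$ the Jacobi polynomial is \[ P_n^{(a,b)}(t)=\frac{1}{n!}\sum_{j=0}^n\binom{n}{j}(j+a+1)_{n-j}(n+a+b+1)_j\left(\frac{t-1}{2}\right)^j . \] The factor $(x+y)^{2k}$ clears the denominator in the argument of $P_k^{(\kappa,\alpha)}$, so $s_{n,k}^{\alpha,\gamma,\kappa}$ is a symmetric polynomial. Order on $\mathbb{N}_0^2$: $(m,l)\prec(n,k)$ if and only if $m+2l<n+2k$, or $m+2l=n+2k$ and $l<k$; this is a strict total order. Every symmetric polynomial is uniquely a finite linear combination of the monomials $(x+y)^n(xy)^k$; the largest pair $(n,k)$ (for $\prec$) occurring with nonzero coefficient is its symmetric degree. Monic orthogonal basis: $p_{n,k}^{\alpha,\gamma,\kappa}$ is obtained by Gram--Schmidt (without normalization of norms, with leading coefficient $1$) from the monomials $(x+y)^n(xy)^k$ ordered by $\prec$; i.e. it is the unique symmetric polynomial equal to $(x+y)^n(xy)^k$ plus a linear combination of $(x+y)^m(xy)^l$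 with $(m,l)\prec(n,k)$, and satisfying $\int_{\triangle}p_{n,k}^{\alpha,\gamma,\kappa}\,q\,w_{\alpha,\gamma,\kappa}\,dx\,dy=0$ for every symmetric polynomial $q$ of symmetric degree $\prec(n,k)$. *)

theory Defs
  imports "HOL-Analysis.Analysis" "HOL-Computational_Algebra.Polynomial"
begin

definition jacobi :: "nat \<Rightarrow> real \<Rightarrow> real \<Rightarrow> real poly" where
  "jacobi n a b = smult (1 / fact n)
     (\<Sum>j\<le>n. smult (real (n choose j) * pochhammer (real j + a + 1) (n - j)
                    * pochhammer (real n + a + b + 1) j)
              ([:-1/2, 1/2:] ^ j))"

text \<open>Polynomials in two variables are identified with the polynomial functions on the plane.\<close>

definition symmetric_polynomial :: "(real \<times> real \<Rightarrow> real) \<Rightarrow> bool" where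
  "symmetric_polynomial p \<longleftrightarrow>
     real_polynomial_function p \<and> (\<forall>x y. p (x, y) = p (y, x))"

definition sym_less :: "nat \<times> nat \<Rightarrow> nat \<times> nat \<Rightarrow> bool"  (infix "\<prec>" 50) where
  "d \<prec> e \<longleftrightarrow> (case d of (m, l) \<Rightarrow> case e of (n, k) \<Rightarrow>
     m + 2 * l < n + 2 * k \<or> (m + 2 * l = n + 2 * k \<and> l < k))"

definition sym_mono :: "nat \<times> nat \<Rightarrow> real \<times> real \<Rightarrow> real" where
  "sym_mono = (\<lambda>(n, k) (x, y). (x + y) ^ n * (x * y) ^ k)"

text \<open>The linear combination with finitely supported coefficient family \<open>c\<close>; the finiteness of the
  support is required wherever this is used.\<close>

definition sym_lincomb :: "(nat \<times> nat \<Rightarrow> real) \<Rightarrow> real \<times> real \<Rightarrow> real" where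
  "sym_lincomb c z = (\<Sum>d | c d \<noteq> 0. c d * sym_mono d z)"

text \<open>A relation rather than a function, because the zero polynomial has no symmetric degree.\<close>

definition has_sym_degree :: "(real \<times> real \<Rightarrow> real) \<Rightarrow> nat \<times> nat \<Rightarrow> bool" where
  "has_sym_degree q d \<longleftrightarrow>
     (\<exists>c. finite {e. c e \<noteq> 0} \<and> (\<forall>z. q z = sym_lincomb c z) \<and>
          c d \<noteq> 0 \<and> (\<forall>e. c e \<noteq> 0 \<longrightarrow> e = d \<or> e \<prec> d))"

definition T2 :: "(real \<times> real) set" where
  "T2 = {(x, y). 0 \<le> x \<and> 0 \<le> y \<and> x + y \<le> 1}"

definition triangle :: "(real \<times> real) set" where
  "triangle = {(x, y) \<in> T2. y < x}"

text \<open>Since \<open>0 powr a = 0\<close> for every \<open>a\<close>, the value on the edges of \<open>triangle\<close> can be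
  unconventional; the edges are null sets.\<close>

definition weight :: "real \<Rightarrow> real \<Rightarrow> real \<Rightarrow> real \<times> real \<Rightarrow> real" where
  "weight \<alpha> \<gamma> \<kappa> = (\<lambda>(x, y).
     (x * y) powr \<alpha> * (1 - x - y) powr \<gamma> * \<bar>x - y\<bar> powr (2 * \<kappa> + 1))"

text \<open>Integrability is stated explicitly because the Bochner integral of a non-integrable function
  is \<open>0\<close> by convention.\<close>

definition is_monic_sym_orth ::
  "real \<Rightarrow> real \<Rightarrow> real \<Rightarrow> nat \<Rightarrow> nat \<Rightarrow> (real \<times> real \<Rightarrow> real) \<Rightarrow> bool" where
  "is_monic_sym_orth \<alpha> \<gamma> \<kappa> n k p \<longleftrightarrow>
     symmetric_polynomial p \<and>
     (\<exists>c. finite {e. c e \<noteq> 0} \<and> (\<forall>e. c e \<noteq> 0 \<longrightarrow> e \<prec> (n, k)) \<and>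
          (\<forall>z. p z = sym_mono (n, k) z + sym_lincomb c z)) \<and>
     (\<forall>q d. symmetric_polynomial q \<and> has_sym_degree q d \<and> d \<prec> (n, k) \<longrightarrow>
        set_integrable lborel triangle (\<lambda>z. p z * q z * weight \<alpha> \<gamma> \<kappa> z) \<and>
        set_lebesgue_integral lborel triangle (\<lambda>z. p z * q z * weight \<alpha> \<gamma> \<kappa> z) = 0)"

definition monic_sym_orth ::
  "real \<Rightarrow> real \<Rightarrow> real \<Rightarrow> nat \<Rightarrow> nat \<Rightarrow> real \<times> real \<Rightarrow> real" where
  "monic_sym_orth \<alpha> \<gamma> \<kappa> n k = (THE p. is_monic_sym_orth \<alpha> \<gamma> \<kappa> n k p)"

text \<open>For \<open>degree p \<le> k\<close> this is \<open>v ^ k * poly p (u / v)\<close> with the denominator cleared, so that it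
  is also meaningful at \<open>v = 0\<close>.\<close>

definition clear_denom :: "nat \<Rightarrow> real poly \<Rightarrow> real \<Rightarrow> real \<Rightarrow> real" where
  "clear_denom k p u v = (\<Sum>j\<le>k. coeff p j * u ^ j * v ^ (k - j))"

definition sym_jacobi_const :: "real \<Rightarrow> real \<Rightarrow> real \<Rightarrow> nat \<Rightarrow> nat \<Rightarrow> real" where
  "sym_jacobi_const \<alpha> \<gamma> \<kappa> n k =
     ((-1) ^ n * fact n * fact k) /
     (4 ^ k * pochhammer (real n + 2 * \<alpha> + 2 * \<kappa> + 4 * real k + \<gamma> + 3) n
            * pochhammer (real k + \<alpha> + \<kappa> + 1) k)"

text \<open>The last factor is \<open>(x + y) ^ (2 * k)\<close> times the Jacobi polynomial at
  \<open>1 - 2 * (x - y)\<^sup>2 / (x + y)\<^sup>2 = ((x + y)\<^sup>2 - 2 * (x - y)\<^sup>2) / (x + y)\<^sup>2\<close>; see lemma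
  \<open>sym_jacobi_eq\<close> below. Writing the quotient directly would, with \<open>a / 0 = 0\<close>, give wrong values
  of the polynomial on the line \<open>x + y = 0\<close>.\<close>

definition sym_jacobi ::
  "real \<Rightarrow> real \<Rightarrow> real \<Rightarrow> nat \<Rightarrow> nat \<Rightarrow> real \<times> real \<Rightarrow> real" where
  "sym_jacobi \<alpha> \<gamma> \<kappa> n k = (\<lambda>(x, y).
     sym_jacobi_const \<alpha> \<gamma> \<kappa> n k *
     poly (jacobi n (2 * \<alpha> + 2 * \<kappa> + 4 * real k + 2) \<gamma>) (1 - 2 * x - 2 * y) *
     clear_denom k (jacobi k \<kappa> \<alpha>) ((x + y)\<^sup>2 - 2 * (x - y)\<^sup>2) ((x + y)\<^sup>2))"

lemma degree_jacobi_le: "degree (jacobi n a b) \<le> n"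
proof -
  have "degree (smult r ([:-1/2, 1/2:] ^ j :: real poly)) \<le> n" if "j \<le> n" for r :: real and j
  proof -
    have "degree ([:-1/2, 1/2:] ^ j :: real poly) \<le> degree ([:-1/2, 1/2:] :: real poly) * j"
      by (rule degree_power_le)
    then show ?thesis
      using that degree_smult_le[of r "[:-1/2, 1/2:] ^ j :: real poly"] by simp
  qed
  then have "degree (\<Sum>j\<le>n. smult (r j) ([:-1/2, 1/2:] ^ j :: real poly)) \<le> n"
    for r :: "nat \<Rightarrow> real"
    by (intro degree_sum_le) (simp_all del: degree_smult_eq)
  then show ?thesis
    unfolding jacobi_def by (rule order.trans[OF degree_smult_le])
qed

lemma clear_denom_eq:
  assumes "degree p \<le> k" "v \<noteq> 0"
  shows "clear_denom k p u v = v ^ k * poly p (u / v)"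
proof -
  have "poly p (u / v) = (\<Sum>j\<le>k. coeff p j * (u / v) ^ j)"
    unfolding poly_altdef using assms(1)
    by (intro sum.mono_neutral_left) (auto simp: coeff_eq_0)
  moreover have "coeff p j * u ^ j * v ^ (k - j) = v ^ k * (coeff p j * (u / v) ^ j)"
    if "j \<le> k" for j
    using assms(2) that by (simp add: power_diff power_divide)
  ultimately show ?thesis
    by (auto simp only: clear_denom_def sum_distrib_left atMost_iff intro!: sum.cong)
qed

lemma sym_jacobi_eq:
  assumes "x + y \<noteq> 0"
  shows "sym_jacobi \<alpha> \<gamma> \<kappa> n k (x, y) =
     sym_jacobi_const \<alpha> \<gamma> \<kappa> n k * (x + y) ^ (2 * k) *
     poly (jacobi n (2 * \<alpha> + 2 * \<kappa> + 4 * real k + 2) \<gamma>) (1 - 2 * x - 2 * y) *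
     poly (jacobi k \<kappa> \<alpha>) (1 - 2 * ((x - y)\<^sup>2 / (x + y)\<^sup>2))"
proof -
  have *: "((x + y)\<^sup>2 - 2 * (x - y)\<^sup>2) / (x + y)\<^sup>2 = 1 - 2 * ((x - y)\<^sup>2 / (x + y)\<^sup>2)"
    using assms by (simp add: diff_divide_distrib)
  show ?thesis
    using assms
    by (simp add: sym_jacobi_def clear_denom_eq[OF degree_jacobi_le] * power_mult)
qed

end

theory Submission imports Defs begin

text \<open>
  In the coordinates \<open>u = x + y\<close>, \<open>r = (x - y) / (x + y)\<close>, with Jacobian \<open>u / 2\<close>, the triangle becomes the unit
  square and the weight splits as \<open>u powr (2 * \<alpha> + 2 * \<kappa> + 2) * (1 - u) powr \<gamma>\<close> times
  \<open>r powr (2 * \<kappa> + 1) * (1 - r\<^sup>2) powr \<alpha>\<close>, up to a constant. The product of \<open>sym_jacobi\<close> and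
  \<open>(x + y) ^ m * (x * y) ^ l\<close> splits as well. If \<open>l < k\<close>, the integral over \<open>r\<close> vanishes (substitute
  \<open>s = r\<^sup>2\<close>); otherwise \<open>m + 2 * l < n + 2 * k\<close> and the integral over \<open>u\<close> vanishes, because
  \<open>u ^ (2 * k + m + 2 * l) = u ^ (4 * k) * u ^ (m + 2 * l - 2 * k)\<close> and the first factor shifts the
  parameter of the weight. The coefficient of the leading monomial comes from
  \<open>(x - y)\<^sup>2 = (x + y)\<^sup>2 - 4 * x * y\<close>. Two monic orthogonal polynomials differ by a polynomial
  orthogonal to itself, hence by zero.
\<close>

subsection \<open>Orthogonality of Jacobi polynomials on the unit interval\<close>

text \<open>Pascal's rule splits each coefficient, which trades one order of the finite difference
  for a first difference of \<open>f\<close>; the induction below rests on this.\<close>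

lemma alternating_binomial_sum_Suc:
  fixes f :: "nat \<Rightarrow> real"
  shows "(\<Sum>j\<le>Suc n. (-1) ^ j * real (Suc n choose j) * f j) =
         (\<Sum>j\<le>n. (-1) ^ j * real (n choose j) * (f j - f (Suc j)))"
proof -
  have "(\<Sum>j\<le>Suc n. (-1) ^ j * real (Suc n choose j) * f j) =
      f 0 + (\<Sum>j\<le>n. (-1) ^ Suc j * real (Suc n choose Suc j) * f (Suc j))"
    by (subst sum.atMost_Suc_shift) simp
  also have "\<dots> = f 0 + (\<Sum>j\<le>n. (-1) ^ Suc j * real (n choose Suc j) * f (Suc j))
      - (\<Sum>j\<le>n. (-1) ^ j * real (n choose j) * f (Suc j))"
    by (simp add: algebra_simps sum.distrib sum_negf sum_subtractf)
  \<comment> \<open>Since \<open>n choose Suc n = 0\<close>, the term with index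
    \<open>Suc n\<close> is zero and can be added freely.\<close>
  also have "f 0 + (\<Sum>j\<le>n. (-1) ^ Suc j * real (n choose Suc j) * f (Suc j)) =
      (\<Sum>j\<le>Suc n. (-1) ^ j * real (n choose j) * f j)"
    by (subst sum.atMost_Suc_shift) simp
  finally show ?thesis
    by (simp add: right_diff_distrib sum_subtractf)
qed

text \<open>Both symbols contain \<open>pochhammer (x + 1) m\<close>; the remaining factors are
  \<open>x\<close> and \<open>x + 1 + m\<close>.\<close>

lemma pochhammer_diff:
  fixes x :: real
  shows "pochhammer x (Suc m) - pochhammer (x + 1) (Suc m) = - real (Suc m) * pochhammer (x + 1) m"
  by (simp only: pochhammer_rec[of x m] pochhammer_rec'[of "x + 1" m]) (simp add: algebra_simps)

text \<open>The symbol is a polynomial of degree \<open>m\<close> in \<open>j\<close>, and an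
  \<open>n\<close>-th difference kills degrees below \<open>n\<close>. Each difference lowers
  \<open>m\<close> and shifts \<open>x\<close>, so the induction generalizes both.\<close>

lemma alternating_binomial_sum_pochhammer:
  fixes x :: real
  assumes "m < n"
  shows "(\<Sum>j\<le>n. (-1) ^ j * real (n choose j) * pochhammer (x + real j) m) = 0"
  using assms
proof (induction n arbitrary: m x)
  case (Suc n)
  show ?case
  proof (cases m)
    case 0
    then show ?thesis
      unfolding alternating_binomial_sum_Suc by simp
  next
    case (Suc l)
    have "(\<Sum>j\<le>n. (-1) ^ j * real (n choose j) * pochhammer (x + 1 + real j) l) = 0"
      using Suc.IH Suc.prems Suc by simp
    moreover have "pochhammer (x + real j) m - pochhammer (x + real (Suc j)) m =
        - real m * pochhammer (x + 1 + real j) l" for j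
      using pochhammer_diff[of "x + real j" l] by (simp add: Suc add_ac)
    ultimately show ?thesis
      unfolding alternating_binomial_sum_Suc
      by (simp only: mult.left_commute[of _ "- real m"] mult_zero_right flip: sum_distrib_left)
  qed
qed simp

section \<open>Beta integrals as moments of the Jacobi weight\<close>

lemma
  fixes f :: "'i \<Rightarrow> 'a \<Rightarrow> real"
  assumes "\<And>i. i \<in> I \<Longrightarrow> set_integrable M A (f i)"
  shows set_integrable_sum: "set_integrable M A (\<lambda>x. \<Sum>i\<in>I. f i x)"
    and set_integral_sum: "(LINT x:A|M. (\<Sum>i\<in>I. f i x)) = (\<Sum>i\<in>I. LINT x:A|M. f i x)"
  using assms unfolding set_integrable_def set_lebesgue_integral_def
  by (simp_all add: sum_distrib_left)

text \<open>At \<open>t = 0\<close> both sides are 0, even for \<open>j = 0\<close>, because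
  \<open>0 powr a = 0\<close> for every \<open>a\<close>.\<close>

lemma power_mult_powr:
  fixes t :: real
  assumes "t \<ge> 0"
  shows "t ^ j * t powr a = t powr (a + real j)"
  using assms by (cases "t = 0") (simp_all add: powr_add powr_realpow)

text \<open>Powers of \<open>t\<close> and \<open>1 - t\<close> only raise the exponents of the
  weight, so each moment is again an Euler integral.\<close>

lemma
  fixes a b :: real
  assumes "a > -1" "b > -1"
  shows set_integrable_beta_moment:
      "set_integrable lborel {0..1} (\<lambda>t. t ^ j * (1 - t) ^ i * (t powr a * (1 - t) powr b))"
    and set_integral_beta_moment:
      "(LINT t:{0..1}|lborel. t ^ j * (1 - t) ^ i * (t powr a * (1 - t) powr b)) =
        Beta (a + 1 + real j) (b + 1 + real i)"
proof -
  define A where "A = a + 1 + real j"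
  define B where "B = b + 1 + real i"
  have AB: "A > 0" "B > 0"
    using assms by (simp_all add: A_def B_def)
  have eq: "t ^ j * (1 - t) ^ i * (t powr a * (1 - t) powr b) = t powr (A - 1) * (1 - t) powr (B - 1)"
    if "t \<in> {0..1}" for t
    using that power_mult_powr[of t j a] power_mult_powr[of "1 - t" i b]
    by (simp add: A_def B_def algebra_simps)
  show int: "set_integrable lborel {0..1} (\<lambda>t. t ^ j * (1 - t) ^ i * (t powr a * (1 - t) powr b))"
    by (subst set_integrable_cong[OF refl refl eq]) (use AB integrable_Beta in auto)
  have "(LINT t:{0..1}|lborel. t ^ j * (1 - t) ^ i * (t powr a * (1 - t) powr b)) =
      (LINT t:{0..1}|lborel. t powr (A - 1) * (1 - t) powr (B - 1))"
    by (rule set_lebesgue_integral_cong) (simp_all add: eq)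
  also have "\<dots> = integral {0..1} (\<lambda>t. t powr (A - 1) * (1 - t) powr (B - 1))"
    by (rule set_borel_integral_eq_integral) (use AB integrable_Beta in auto)
  also have "\<dots> = Beta A B"
    using has_integral_Beta_real[OF AB] by (rule integral_unique)
  finally show "(LINT t:{0..1}|lborel. t ^ j * (1 - t) ^ i * (t powr a * (1 - t) powr b)) =
      Beta (a + 1 + real j) (b + 1 + real i)"
    by (simp add: A_def B_def)
qed

text \<open>Later integrability claims are instances of this one, with arguments such as
  \<open>1 - 2 * t\<close> encoded by \<open>pcompose\<close>.\<close>

lemma set_integrable_poly_beta:
  fixes a b :: real
  assumes "a > -1" "b > -1"
  shows "set_integrable lborel {0..1} (\<lambda>t. poly p t * (t powr a * (1 - t) powr b))"
  unfolding poly_altdef sum_distrib_right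
  using set_integrable_beta_moment[OF assms, of _ 0]
  by (intro set_integrable_sum) (simp_all add: mult.assoc)

lemma poly_jacobi_affine:
  "poly (jacobi n a b) (1 - 2 * t) = 1 / fact n *
     (\<Sum>j\<le>n. real (n choose j) * pochhammer (real j + a + 1) (n - j)
        * pochhammer (real n + a + b + 1) j * (- t) ^ j)"
  by (simp add: jacobi_def poly_sum diff_divide_distrib)

text \<open>The Gamma factors cancel so that the expanded integral is an \<open>n\<close>-th finite difference of a
  polynomial of degree \<open>n - 1 - i\<close> in the summation index.\<close>

lemma set_integral_jacobi_power:
  fixes a b :: real
  assumes ab: "a > -1" "b > -1" and "i < n"
  shows "(LINT t:{0..1}|lborel. poly (jacobi n a b) (1 - 2 * t) * (1 - t) ^ i * (t powr a * (1 - t) powr b)) = 0"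
proof -
  \<comment> \<open>\<open>C\<close> collects the Gamma factors that do not involve the summation
    index.\<close>
  define C where "C = Gamma (a + 1 + real n) * Gamma (b + 1 + real i) / Gamma (real n + a + b + 1)"
  \<comment> \<open>From \<open>i < n\<close> follows \<open>n \<ge> 1\<close>, which compensates
    for \<open>a + b > -2\<close>.\<close>
  have pos: "real n + a + b + 1 > 0"
    using assms by linarith
  let ?P = "\<lambda>j. real (n choose j) * pochhammer (real j + a + 1) (n - j) * pochhammer (real n + a + b + 1) j"
  have summand: "?P j * (-1) ^ j * Beta (a + 1 + real j) (b + 1 + real i) =
      C * ((-1) ^ j * real (n choose j) * pochhammer (a + b + 2 + real i + real j) (n - 1 - i))"
    if "j \<le> n" for j
  proof -
    have g: "Gamma (a + 1 + real j) > 0" "Gamma (real n + a + b + 1) > 0"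
      "Gamma (a + b + 2 + real i + real j) > 0"
      using ab pos by (auto intro!: Gamma_real_pos)
    have n: "z \<notin> \<int>\<^sub>\<le>\<^sub>0" if "z > 0" for z :: real
      using that by (auto elim!: nonpos_Ints_cases)
    have "pochhammer (real j + a + 1) (n - j) = Gamma (a + 1 + real n) / Gamma (a + 1 + real j)"
      using that ab by (subst pochhammer_Gamma) (auto intro!: n simp: of_nat_diff add_ac)
    moreover have "pochhammer (real n + a + b + 1) j =
        Gamma (a + b + 1 + real n + real j) / Gamma (real n + a + b + 1)"
      using pos by (subst pochhammer_Gamma) (auto intro!: n simp: add_ac)
    moreover have "pochhammer (a + b + 2 + real i + real j) (n - 1 - i) =
        Gamma (a + b + 1 + real n + real j) / Gamma (a + b + 2 + real i + real j)"
      using assms by (subst pochhammer_Gamma) (auto intro!: n simp: of_nat_diff algebra_simps)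
    moreover have "Beta (a + 1 + real j) (b + 1 + real i) =
        Gamma (a + 1 + real j) * Gamma (b + 1 + real i) / Gamma (a + b + 2 + real i + real j)"
      by (simp add: Beta_def add_ac)
    ultimately show ?thesis
      using g by (simp add: C_def)
  qed
  have "(LINT t:{0..1}|lborel. poly (jacobi n a b) (1 - 2 * t) * (1 - t) ^ i * (t powr a * (1 - t) powr b)) =
      (LINT t:{0..1}|lborel. 1 / fact n * (\<Sum>j\<le>n. ?P j * (-1) ^ j *
        (t ^ j * (1 - t) ^ i * (t powr a * (1 - t) powr b))))"
  proof (intro set_lebesgue_integral_cong allI impI)
    fix t :: real
    show " poly (jacobi n a b) (1 - 2 * t) * (1 - t) ^ i * (t powr a * (1 - t) powr b) =
      1 / fact n * (\<Sum>j\<le>n. ?P j * (-1) ^ j *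
        (t ^ j * (1 - t) ^ i * (t powr a * (1 - t) powr b)))"
      unfolding poly_jacobi_affine
      by (auto simp: sum_distrib_left sum_distrib_right power_minus[of t] mult_ac
          intro!: sum.cong)
  qed simp
  also have "\<dots> = 1 / fact n * (\<Sum>j\<le>n. ?P j * (-1) ^ j * Beta (a + 1 + real j) (b + 1 + real i))"
    unfolding set_integral_mult_right using set_integrable_beta_moment[OF ab]
    by (subst set_integral_sum) (simp_all add: set_integral_beta_moment[OF ab])
  also have "\<dots> = 1 / fact n * (C * (\<Sum>j\<le>n. (-1) ^ j * real (n choose j) *
      pochhammer (a + b + 2 + real i + real j) (n - 1 - i)))"
    unfolding sum_distrib_left[of C] using summand
    by (intro arg_cong[where f = "(*) _"] sum.cong) auto
  also have "\<dots> = 0"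
    using assms by (subst alternating_binomial_sum_pochhammer) simp_all
  finally show ?thesis .
qed

text \<open>Expand \<open>q\<close> in powers of \<open>1 - t\<close>: these leave intact the factor
  \<open>Gamma (a + 1 + j)\<close> of the Beta values, whose cancellation drives the previous
  lemma.\<close>

lemma jacobi_orthogonal:
  fixes a b :: real
  assumes ab: "a > -1" "b > -1" and "degree q < n"
  shows "(LINT t:{0..1}|lborel. poly (jacobi n a b) (1 - 2 * t) * poly q t * (t powr a * (1 - t) powr b)) = 0"
proof -
  \<comment> \<open>The map \<open>t\<close> to \<open>1 - t\<close> is an involution, so the
    coefficients of \<open>?q\<close> are those of \<open>q\<close> in powers of
    \<open>1 - t\<close>.\<close>
  let ?q = "pcompose q [:1, -1:]"
  have q: "poly q t = (\<Sum>i\<le>degree q. coeff ?q i * (1 - t) ^ i)" for t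
  proof -
    have "poly q t = poly ?q (1 - t)"
      by (simp add: poly_pcompose)
    then show ?thesis
      by (simp add: poly_altdef degree_pcompose)
  qed
  have int: "set_integrable lborel {0..1}
      (\<lambda>t. poly (jacobi n a b) (1 - 2 * t) * (1 - t) ^ i * (t powr a * (1 - t) powr b))" for i
    using set_integrable_poly_beta[OF ab, of "pcompose (jacobi n a b) [:1, -2:] * [:1, -1:] ^ i"]
    by (simp add: poly_pcompose mult.commute)
  have "(LINT t:{0..1}|lborel. poly (jacobi n a b) (1 - 2 * t) * poly q t * (t powr a * (1 - t) powr b)) =
      (LINT t:{0..1}|lborel. (\<Sum>i\<le>degree q. coeff ?q i *
        (poly (jacobi n a b) (1 - 2 * t) * (1 - t) ^ i * (t powr a * (1 - t) powr b))))"
    by (rule arg_cong[where f = "set_lebesgue_integral _ _"])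
       (simp add: q sum_distrib_left sum_distrib_right mult_ac)
  also have "\<dots> = 0"
    using assms int by (subst set_integral_sum) (simp_all add: set_integral_jacobi_power)
  finally show ?thesis .
qed

subsection \<open>Polar-type coordinates on the triangle\<close>

definition tri_param :: "real \<times> real \<Rightarrow> real \<times> real" where
  "tri_param = (\<lambda>(u, r). (u * (1 + r) / 2, u * (1 - r) / 2))"

text \<open>Half-open to match \<open>triangle\<close>: \<open>u = 0\<close> collapses to the origin
  and \<open>r = 0\<close> is the excluded diagonal, while \<open>u = 1\<close> and
  \<open>r = 1\<close> are edges that belong to it.\<close>

definition unit_square :: "(real \<times> real) set" where
  "unit_square = {0<..1} \<times> {0<..1}"

lemma triangle_borel [measurable]: "triangle \<in> sets borel"
proof -
  have eq: "triangle = {z. 0 \<le> fst z} \<inter> {z. 0 \<le> snd z} \<inter> {z. fst z + snd z \<le> 1} \<inter> {z. snd z < fst z}"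
    by (auto simp: triangle_def T2_def)
  have "{z::real\<times>real. 0 \<le> fst z} \<in> sets borel" "{z::real\<times>real. 0 \<le> snd z} \<in> sets borel"
    "{z::real\<times>real. fst z + snd z \<le> 1} \<in> sets borel" "{z::real\<times>real. snd z < fst z} \<in> sets borel"
    by ((rule borel_closed, rule closed_Collect_le; intro continuous_intros)+)
       (rule borel_open, rule open_Collect_less; intro continuous_intros)
  then show ?thesis
    unfolding eq by (intro sets.Int)
qed

lemma borel_measurable_fst_plane [measurable]: "(\<lambda>z::real \<times> real. fst z) \<in> borel_measurable borel"
  by (intro borel_measurable_continuous_onI continuous_intros)

lemma unit_square_borel [measurable]: "unit_square \<in> sets borel"
  unfolding unit_square_def borel_prod[symmetric] by (intro pair_measureI) auto

lemma tri_param_measurable [measurable]: "tri_param \<in> borel_measurable borel"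
  unfolding tri_param_def split_beta'
  by (intro borel_measurable_continuous_onI continuous_intros) simp_all

text \<open>Tonelli splits the coordinate change into two affine substitutions in one variable:
  \<open>x = u - y\<close> for fixed \<open>y\<close>, then \<open>y = u * (1 - r) / 2\<close> for
  fixed \<open>u\<close>. The second one produces the Jacobian \<open>u / 2\<close>.\<close>

lemma nn_integral_triangle:
  fixes f :: "real \<times> real \<Rightarrow> ennreal"
  assumes [measurable]: "f \<in> borel_measurable borel"
  shows "(\<integral>\<^sup>+z. f z * indicator triangle z \<partial>lborel) =
    (\<integral>\<^sup>+z. f (tri_param z) * ennreal (fst z / 2) * indicator unit_square z \<partial>lborel)"
proof -
  define g where "g z = f z * indicator triangle z" for z
  have [measurable]: "g \<in> borel_measurable (borel \<Otimes>\<^sub>M borel)"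
    unfolding g_def borel_prod by measurable
  have [measurable]: "(\<lambda>z. f (tri_param z) * ennreal (fst z / 2) * indicator unit_square z)
      \<in> borel_measurable (borel \<Otimes>\<^sub>M borel)"
    unfolding borel_prod by measurable
  have g: "g \<in> borel_measurable (lborel \<Otimes>\<^sub>M lborel)"
    by measurable
  have inner: "(\<integral>\<^sup>+y. g (u - y, y) \<partial>lborel) =
      (\<integral>\<^sup>+r. f (tri_param (u, r)) * ennreal (u / 2) * indicator unit_square (u, r) \<partial>lborel)" for u
  proof (cases "u > 0")
    \<comment> \<open>For \<open>u \<le> 0\<close> the line \<open>x + y = u\<close> misses the
      triangle, where \<open>0 \<le> y < x\<close>.\<close>
    case False
    then have "g (u - y, y) = 0" for y
      by (auto simp: g_def triangle_def T2_def split: split_indicator)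
    with False show ?thesis
      by (simp add: unit_square_def indicator_def)
  next
    case True
    have "(\<integral>\<^sup>+y. g (u - y, y) \<partial>lborel) =
        ennreal (u / 2) * (\<integral>\<^sup>+r. g (u - (u / 2 + (- (u / 2)) * r), u / 2 + (- (u / 2)) * r) \<partial>lborel)"
      using True by (subst nn_integral_real_affine[where c = "- (u / 2)" and t = "u / 2"]) simp_all
    also have "\<dots> = (\<integral>\<^sup>+r. ennreal (u / 2) *
        g (u - (u / 2 + (- (u / 2)) * r), u / 2 + (- (u / 2)) * r) \<partial>lborel)"
      by (rule nn_integral_cmult[symmetric]) simp
    also have "\<dots> = (\<integral>\<^sup>+r. f (tri_param (u, r)) * ennreal (u / 2) * indicator unit_square (u, r) \<partial>lborel)"
    proof (rule nn_integral_cong)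
      fix r
      have eq: "(u - (u / 2 + (- (u / 2)) * r), u / 2 + (- (u / 2)) * r) = tri_param (u, r)"
        by (simp add: tri_param_def field_simps)
      have "tri_param (u, r) \<in> triangle \<longleftrightarrow> (u, r) \<in> unit_square"
      proof -
        have "u * (1 - r) / 2 \<ge> 0 \<longleftrightarrow> r \<le> 1"
          using True by (simp add: zero_le_mult_iff)
        moreover have "u * (1 - r) / 2 < u * (1 + r) / 2 \<longleftrightarrow> r > 0"
          using True by (simp add: zero_less_mult_iff field_simps)
        moreover have "u * (1 + r) / 2 + u * (1 - r) / 2 = u"
          by (simp add: field_simps)
        ultimately show ?thesis
          using True by (auto simp: tri_param_def triangle_def T2_def unit_square_def)
      qed
      then show "ennreal (u / 2) * g (u - (u / 2 + (- (u / 2)) * r), u / 2 + (- (u / 2)) * r) =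
          f (tri_param (u, r)) * ennreal (u / 2) * indicator unit_square (u, r)"
        unfolding eq g_def by (auto simp: mult_ac split: split_indicator)
    qed
    finally show ?thesis .
  qed
  have "(\<integral>\<^sup>+z. f z * indicator triangle z \<partial>lborel) = (\<integral>\<^sup>+y. \<integral>\<^sup>+x. g (x, y) \<partial>lborel \<partial>lborel)"
    using lborel_pair.nn_integral_snd[OF g] by (simp add: g_def[abs_def] lborel_prod)
  also have "\<dots> = (\<integral>\<^sup>+y. \<integral>\<^sup>+u. g (u - y, y) \<partial>lborel \<partial>lborel)"
  proof (rule nn_integral_cong)
    fix y
    show "(\<integral>\<^sup>+x. g (x, y) \<partial>lborel) = (\<integral>\<^sup>+u. g (u - y, y) \<partial>lborel)"
      by (subst nn_integral_real_affine[where c = 1 and t = "- y"]) simp_all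
  qed
  also have "\<dots> = (\<integral>\<^sup>+u. \<integral>\<^sup>+y. g (u - y, y) \<partial>lborel \<partial>lborel)"
    by (rule lborel_pair.Fubini') simp
  also have "\<dots> = (\<integral>\<^sup>+u. \<integral>\<^sup>+r. f (tri_param (u, r)) * ennreal (u / 2) * indicator unit_square (u, r) \<partial>lborel \<partial>lborel)"
    by (simp only: inner)
  also have "\<dots> = (\<integral>\<^sup>+z. f (tri_param z) * ennreal (fst z / 2) * indicator unit_square z \<partial>lborel)"
    by (subst lborel_prod[symmetric], subst lborel.nn_integral_fst[symmetric]) simp_all
  finally show ?thesis .
qed

text \<open>As an equality of measures, the change of variables carries over to signed functions,
  for integrability and integrals alike.\<close>

lemma triangle_eq_distr:
  "density lborel (\<lambda>z. ennreal (indicator triangle z)) =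
     distr (density lborel (\<lambda>z. ennreal (fst z / 2 * indicator unit_square z))) borel tri_param"
proof (rule measure_eqI)
  fix A
  assume "A \<in> sets (density lborel (\<lambda>z. ennreal (indicator triangle z)))"
  then have [measurable]: "A \<in> sets borel"
    by simp
  have [measurable]: "(\<lambda>z::real\<times>real. fst z / 2 * indicator unit_square z) \<in> borel_measurable borel"
    by measurable
  have *: "tri_param -` A \<in> sets borel"
    using measurable_sets[OF tri_param_measurable \<open>A \<in> sets borel\<close>] by simp
  have "emeasure (density lborel (\<lambda>z. ennreal (indicator triangle z))) A =
      (\<integral>\<^sup>+z. indicator A z * indicator triangle z \<partial>lborel)"
    by (subst emeasure_density) (auto simp: ennreal_indicator mult_ac)
  also have "\<dots> = (\<integral>\<^sup>+z. indicator A (tri_param z) * ennreal (fst z / 2) * indicator unit_square z \<partial>lborel)"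
    by (rule nn_integral_triangle) measurable
  also have "\<dots> = (\<integral>\<^sup>+z. ennreal (fst z / 2 * indicator unit_square z) * indicator (tri_param -` A) z \<partial>lborel)"
    by (intro nn_integral_cong) (auto split: split_indicator)
  also have "\<dots> = emeasure (distr (density lborel (\<lambda>z. ennreal (fst z / 2 * indicator unit_square z))) borel tri_param) A"
    using * by (subst emeasure_distr) (simp_all add: emeasure_density)
  finally show "emeasure (density lborel (\<lambda>z. ennreal (indicator triangle z))) A = \<dots>" .
qed simp

lemma
  fixes f :: "real \<times> real \<Rightarrow> real"
  assumes [measurable]: "f \<in> borel_measurable borel"
  shows set_integrable_triangle_iff: "set_integrable lborel triangle f \<longleftrightarrow>
      set_integrable lborel unit_square (\<lambda>z. fst z / 2 * f (tri_param z))" (is ?int)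
    and set_integral_triangle: "(LINT z:triangle|lborel. f z) =
      (LINT z:unit_square|lborel. fst z / 2 * f (tri_param z))" (is ?eq)
proof -
  have [measurable]: "(\<lambda>z::real\<times>real. fst z / 2 * indicator unit_square z) \<in> borel_measurable borel"
    by measurable
  \<comment> \<open>\<open>density\<close> takes values in \<open>ennreal\<close>, where negative
    reals become 0, so the Jacobian must be nonnegative.\<close>
  have nn: "AE z::real\<times>real in lborel. 0 \<le> fst z / 2 * indicator unit_square z"
    by (auto simp: unit_square_def split: split_indicator)
  have [measurable]: "(\<lambda>z. f (tri_param z)) \<in> borel_measurable borel"
    by measurable
  have "set_integrable lborel triangle f \<longleftrightarrow> integrable (density lborel (\<lambda>z. ennreal (indicator triangle z))) f"
    unfolding set_integrable_def by (subst integrable_density) simp_all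
  also have "\<dots> \<longleftrightarrow> set_integrable lborel unit_square (\<lambda>z. fst z / 2 * f (tri_param z))"
    unfolding triangle_eq_distr set_integrable_def using nn
    by (subst integrable_distr_eq, simp_all, subst integrable_density)
       (simp_all add: mult_ac)
  finally show ?int .
  have "(LINT z:triangle|lborel. f z) = integral\<^sup>L (density lborel (\<lambda>z. ennreal (indicator triangle z))) f"
    unfolding set_lebesgue_integral_def by (subst integral_density) simp_all
  also have "\<dots> = (LINT z:unit_square|lborel. fst z / 2 * f (tri_param z))"
    unfolding triangle_eq_distr set_lebesgue_integral_def using nn
    by (subst integral_distr, simp_all, subst integral_density)
       (simp_all add: mult_ac)
  finally show ?eq .
qed

lemma
  fixes F G :: "real \<Rightarrow> real"
  assumes F: "integrable lborel F" and G: "integrable lborel G"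
  shows integrable_lborel_prod_mult: "integrable lborel (\<lambda>z. F (fst z) * G (snd z))" (is ?int)
    and integral_lborel_prod_mult:
      "(LINT z|lborel. F (fst z) * G (snd z)) = integral\<^sup>L lborel F * integral\<^sup>L lborel G" (is ?eq)
proof -
  have [measurable]: "F \<in> borel_measurable borel" "G \<in> borel_measurable borel"
    using F G by auto
  have int: "integrable (lborel \<Otimes>\<^sub>M lborel) (\<lambda>z. F (fst z) * G (snd z))"
    by (rule lborel_pair.Fubini_integrable) (use F G in \<open>simp_all add: abs_mult\<close>)
  then show ?int
    by (simp add: lborel_prod)
  have "(LINT z|lborel. F (fst z) * G (snd z)) = (LINT x|lborel. LINT y|lborel. F x * G y)"
    using lborel_pair.integral_fst'[OF int] by (simp add: lborel_prod)
  then show ?eq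
    by simp
qed

subsection \<open>Symmetric polynomials and the leading term\<close>

text \<open>Lets combinations with different supports be added over one common index set.\<close>

lemma sym_lincomb_superset:
  assumes "finite S" "{d. c d \<noteq> 0} \<subseteq> S"
  shows "sym_lincomb c z = (\<Sum>d\<in>S. c d * sym_mono d z)"
  unfolding sym_lincomb_def using assms by (intro sum.mono_neutral_left) auto

text \<open>Isolates the linear part of monicity: \<open>p\<close> is monic when
  \<open>p - sym_mono (n, k)\<close> lies in this subspace, whose closure properties can be proved
  once.\<close>

definition lower_comb :: "nat \<times> nat \<Rightarrow> (real \<times> real \<Rightarrow> real) \<Rightarrow> bool" where
  "lower_comb d f \<longleftrightarrow>
     (\<exists>c. finite {e. c e \<noteq> 0} \<and> (\<forall>e. c e \<noteq> 0 \<longrightarrow> e \<prec> d) \<and> (\<forall>z. f z = sym_lincomb c z))"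

lemma lower_comb_sym_mono:
  fixes d e :: "nat \<times> nat"
  assumes "e \<prec> d"
  shows "lower_comb d (\<lambda>z. r * sym_mono e z)"
proof -
  have "finite {e'. (if e' = e then r else 0) \<noteq> 0}"
    by (rule finite_subset[of _ "{e}"]) auto
  moreover have "r * sym_mono e z = sym_lincomb (\<lambda>e'. if e' = e then r else 0) z" for z
    by (subst sym_lincomb_superset[of "{e}"]) auto
  ultimately show ?thesis
    unfolding lower_comb_def using assms by (intro exI[of _ "\<lambda>e'. if e' = e then r else 0"]) auto
qed

lemma lower_comb_add_scaled:
  assumes "lower_comb d f" "lower_comb d g"
  shows "lower_comb d (\<lambda>z. f z + r * g z)"
proof -
  obtain a where a: "finite {e. a e \<noteq> 0}" "\<And>e. a e \<noteq> 0 \<Longrightarrow> e \<prec> d" "\<And>z. f z = sym_lincomb a z"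
    using assms(1) unfolding lower_comb_def by auto
  obtain b where b: "finite {e. b e \<noteq> 0}" "\<And>e. b e \<noteq> 0 \<Longrightarrow> e \<prec> d" "\<And>z. g z = sym_lincomb b z"
    using assms(2) unfolding lower_comb_def by auto
  let ?S = "{e. a e \<noteq> 0} \<union> {e. b e \<noteq> 0}"
  let ?c = "\<lambda>e. a e + r * b e"
  have sub: "{e. ?c e \<noteq> 0} \<subseteq> ?S"
    by auto
  have fin: "finite ?S"
    using a b by simp
  have "f z + r * g z = sym_lincomb ?c z" for z
    unfolding a(3) b(3) using fin sub
    by (simp add: sym_lincomb_superset[of ?S] algebra_simps sum.distrib sum_distrib_left)
  moreover have "e \<prec> d" if "?c e \<noteq> 0" for e
    using that a(2)[of e] b(2)[of e] by (cases "a e = 0") auto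
  ultimately show ?thesis
    unfolding lower_comb_def using finite_subset[OF sub fin] by (intro exI[of _ ?c]) auto
qed

lemma lower_comb_zero: "lower_comb d (\<lambda>z. 0)"
  unfolding lower_comb_def by (intro exI[of _ "\<lambda>_. 0"]) (simp add: sym_lincomb_def)

lemma lower_comb_sum:
  assumes "\<And>i. i \<in> I \<Longrightarrow> lower_comb d (f i)"
  shows "lower_comb d (\<lambda>z. \<Sum>i\<in>I. f i z)"
  using assms
proof (induction I rule: infinite_finite_induct)
  case (insert i I)
  then show ?case
    using lower_comb_add_scaled[of d "f i" "\<lambda>z. \<Sum>i\<in>I. f i z" 1] by simp
qed (simp_all add: lower_comb_zero)

lemma symmetric_polynomial_sym_mono: "symmetric_polynomial (sym_mono d)"
proof -
  have "bounded_linear (fst :: real \<times> real \<Rightarrow> real)" "bounded_linear (snd :: real \<times> real \<Rightarrow> real)"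
    by (rule bounded_linear_fst bounded_linear_snd)+
  then have "real_polynomial_function (\<lambda>z. (fst z + snd z) ^ fst d * (fst z * snd z) ^ snd d :: real)"
    by (intro real_polynomial_function_power real_polynomial_function.intros)
  then show ?thesis
    by (simp add: symmetric_polynomial_def sym_mono_def split_beta' add.commute mult.commute)
qed

lemma symmetric_polynomial_add_scaled:
  assumes "symmetric_polynomial f" "symmetric_polynomial g"
  shows "symmetric_polynomial (\<lambda>z. f z + r * g z)"
  using assms unfolding symmetric_polynomial_def
  by (auto intro!: real_polynomial_function.intros(2-4))

lemma symmetric_polynomial_lincomb: "symmetric_polynomial (sym_lincomb c)"
proof -
  have "real_polynomial_function (sym_lincomb c)"
    unfolding sym_lincomb_def[abs_def]
  \<comment> \<open>With infinite support the sum is 0 by convention, hence a constant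
    polynomial.\<close>
  proof (cases "finite {d. c d \<noteq> 0}")
    case True
    then show "real_polynomial_function (\<lambda>z. \<Sum>d | c d \<noteq> 0. c d * sym_mono d z)"
      using symmetric_polynomial_sym_mono unfolding symmetric_polynomial_def
      by (intro real_polynomial_function_sum real_polynomial_function.intros(2-4)) blast+
  qed (simp add: real_polynomial_function.intros(2))
  then show ?thesis
    using symmetric_polynomial_sym_mono by (simp add: symmetric_polynomial_def sym_lincomb_def)
qed

lemma lower_comb_symmetric_polynomial:
  assumes "lower_comb d f"
  shows "symmetric_polynomial f"
proof -
  obtain c where "\<And>z. f z = sym_lincomb c z"
    using assms unfolding lower_comb_def by auto
  then have "f = sym_lincomb c"
    by auto
  then show ?thesis
    using symmetric_polynomial_lincomb by simp
qed

section \<open>Leading coefficients and expansion in symmetric monomials\<close>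

lemma coeff_jacobi:
  "coeff (jacobi n a b) n = pochhammer (real n + a + b + 1) n / (fact n * 2 ^ n)"
proof -
  have "coeff ([:-1/2, 1/2:] ^ j :: real poly) n = (if j = n then (1/2) ^ n else 0)" if "j \<le> n" for j
    using that
    by (cases "j = n")
       (auto simp: coeff_linear_poly_power intro!: coeff_eq_0 le_less_trans[OF degree_power_le])
  then have "coeff (jacobi n a b) n = 1 / fact n * (\<Sum>j\<le>n. real (n choose j) * pochhammer (real j + a + 1) (n - j)
      * pochhammer (real n + a + b + 1) j * (if j = n then (1/2) ^ n else 0))"
    unfolding jacobi_def coeff_smult coeff_sum by (intro arg_cong2[where f = "(*)"] refl sum.cong) auto
  also have "\<dots> = pochhammer (real n + a + b + 1) n / (fact n * 2 ^ n)"
    by (simp add: if_distrib[where f = "(*) _"] power_divide cong: if_cong)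
  finally show ?thesis .
qed

text \<open>Stated at index \<open>k\<close> instead of the degree, since a Jacobi polynomial may
  have degree below its index; both sides are then 0.\<close>

lemma coeff_pcompose_linear:
  fixes p :: "real poly"
  assumes "degree p \<le> k" "b \<noteq> 0"
  shows "coeff (pcompose p [:a, b:]) k = coeff p k * b ^ k"
proof (cases "degree p = k")
  case True
  then show ?thesis
    using lead_coeff_comp[of "[:a, b:]" p] assms(2) by (simp add: degree_pcompose)
next
  case False
  then show ?thesis
    using assms by (simp add: coeff_eq_0 degree_pcompose)
qed

lemma clear_denom_zero: "clear_denom k p u 0 = coeff p k * u ^ k"
proof -
  have "clear_denom k p u 0 = (\<Sum>j\<in>{k}. coeff p j * u ^ j * 0 ^ (k - j))"
    unfolding clear_denom_def by (rule sum.mono_neutral_right) auto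
  then show ?thesis
    by simp
qed

text \<open>For \<open>v \<noteq> 0\<close> the argument is \<open>a + b * (u / v)\<close>; at
  \<open>v = 0\<close> only the coefficient at \<open>k\<close> survives. It is applied with
  \<open>u = x * y\<close> and \<open>v = (x + y) ^ 2\<close>.\<close>

lemma clear_denom_pcompose:
  assumes "degree p \<le> k" "b \<noteq> 0"
  shows "clear_denom k p (b * u + a * v) v = clear_denom k (pcompose p [:a, b:]) u v"
proof (cases "v = 0")
  case True
  then show ?thesis
    using assms by (simp add: clear_denom_zero coeff_pcompose_linear power_mult_distrib)
next
  case False
  have "(b * u + a * v) / v = a + u / v * b"
    using False by (simp add: field_simps)
  then show ?thesis
    using False assms by (simp add: clear_denom_eq degree_pcompose poly_pcompose)
qed

text \<open>Expanding both Jacobi factors yields only monomials \<open>(i + 2 * (k - j), j)\<close>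
  with \<open>i \<le> n\<close> and \<open>j \<le> k\<close>. Their weighted degree is
  \<open>i + 2 * k\<close>, so all but \<open>(n, k)\<close> are smaller, and the constant
  normalizes that one.\<close>

lemma sym_jacobi_monic:
  assumes "\<gamma> > -1" and "\<alpha> + \<kappa> > -3/2"
  shows "lower_comb (n, k) (\<lambda>z. sym_jacobi \<alpha> \<gamma> \<kappa> n k z - sym_mono (n, k) z)"
proof -
  define c where "c = sym_jacobi_const \<alpha> \<gamma> \<kappa> n k"
  define P where "P = jacobi n (2 * \<alpha> + 2 * \<kappa> + 4 * real k + 2) \<gamma>"
  define A where "A = coeff (pcompose P [:1, -2:])"
  define B where "B = coeff (pcompose (jacobi k \<kappa> \<alpha>) [:-1, 8:])"
  \<comment> \<open>The inner slopes -2 and 8 meet the denominators \<open>2 ^ n\<close> and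
    \<open>2 ^ k\<close> of \<open>coeff_jacobi\<close>, which leaves
    \<open>(-1) ^ n * 4 ^ k\<close>.\<close>
  have "A n * B k = ((-1) ^ n * 4 ^ k *
      (pochhammer (real n + 2 * \<alpha> + 2 * \<kappa> + 4 * real k + \<gamma> + 3) n * pochhammer (real k + \<alpha> + \<kappa> + 1) k)) /
      (fact n * fact k)"
  proof -
    have "(8::real) ^ k = 4 ^ k * 2 ^ k" "(-2::real) ^ n = (-1) ^ n * 2 ^ n"
      by (simp_all flip: power_mult_distrib)
    then show ?thesis
      unfolding A_def B_def P_def
      by (simp add: coeff_pcompose_linear degree_jacobi_le coeff_jacobi) (simp add: add_ac)
  qed
  \<comment> \<open>For \<open>n = 0\<close> the base may be negative, but the symbol is then 1; for
    \<open>n \<ge> 1\<close> the hypotheses make the base positive. The same split serves for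
    \<open>k\<close>.\<close>
  moreover have "pochhammer (real n + 2 * \<alpha> + 2 * \<kappa> + 4 * real k + \<gamma> + 3) n \<noteq> 0"
  proof (cases n)
    case (Suc i)
    then have "real n + 2 * \<alpha> + 2 * \<kappa> + 4 * real k + \<gamma> + 3 > 0"
      using assms by simp
    then show ?thesis
      using pochhammer_pos[of "real n + 2 * \<alpha> + 2 * \<kappa> + 4 * real k + \<gamma> + 3" n] by linarith
  qed simp
  moreover have "pochhammer (real k + \<alpha> + \<kappa> + 1) k \<noteq> 0"
  proof (cases k)
    case (Suc i)
    then have "real k + \<alpha> + \<kappa> + 1 > 0"
      using assms by simp
    then show ?thesis
      using pochhammer_pos[of "real k + \<alpha> + \<kappa> + 1" k] by linarith
  qed simp
  ultimately have lead: "c * A n * B k = 1"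
    unfolding c_def sym_jacobi_const_def by (cases "even n") (simp_all add: field_simps)

  define t where "t i j z = c * A i * B j * sym_mono (i + 2 * (k - j), j) z" for i j z
  have "sym_jacobi \<alpha> \<gamma> \<kappa> n k (x, y) = (\<Sum>(i, j)\<in>{..n} \<times> {..k}. t i j (x, y))" for x y
  proof -
    have "poly P (1 - 2 * x - 2 * y) = poly (pcompose P [:1, -2:]) (x + y)"
      by (simp add: poly_pcompose algebra_simps)
    also have "\<dots> = (\<Sum>i\<le>n. A i * (x + y) ^ i)"
      unfolding poly_altdef A_def using degree_jacobi_le
      by (intro sum.mono_neutral_left) (auto simp: coeff_eq_0 P_def degree_pcompose)
    finally have 1: "poly P (1 - 2 * x - 2 * y) = (\<Sum>i\<le>n. A i * (x + y) ^ i)" .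
    have "(x + y)\<^sup>2 - 2 * (x - y)\<^sup>2 = 8 * (x * y) + (-1) * (x + y)\<^sup>2"
      by (simp add: power2_eq_square algebra_simps)
    then have 2: "clear_denom k (jacobi k \<kappa> \<alpha>) ((x + y)\<^sup>2 - 2 * (x - y)\<^sup>2) ((x + y)\<^sup>2) =
        (\<Sum>j\<le>k. B j * (x * y) ^ j * (x + y) ^ (2 * (k - j)))"
      by (simp only:) (subst clear_denom_pcompose, simp_all add: degree_jacobi_le clear_denom_def B_def power_mult)
    show ?thesis
      by (simp add: sym_jacobi_def 2 1[unfolded P_def] sum_product flip: sum.cartesian_product c_def)
         (simp add: sum_distrib_left t_def sym_mono_def power_add mult_ac, rule sum.swap)
  qed
  then have "sym_jacobi \<alpha> \<gamma> \<kappa> n k z - sym_mono (n, k) z =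
      (\<Sum>(i, j)\<in>{..n} \<times> {..k} - {(n, k)}. t i j z)" for z
    using lead by (cases z) (simp add: sum_diff1 t_def)
  moreover have "lower_comb (n, k) (\<lambda>z. case p of (i, j) \<Rightarrow> t i j z)"
    if "p \<in> {..n} \<times> {..k} - {(n, k)}" for p
    unfolding t_def using that by (cases p) (auto intro!: lower_comb_sym_mono simp: sym_less_def)
  ultimately show ?thesis
    using lower_comb_sum[of "{..n} \<times> {..k} - {(n, k)}" "(n, k)" "\<lambda>p z. case p of (i, j) \<Rightarrow> t i j z"] by simp
qed

subsection \<open>Orthogonality with respect to the weight\<close>

text \<open>The factor \<open>r\<close> comes from the substitution \<open>s = r ^ 2\<close>, or
  from the Jacobian when applied to \<open>u\<close>.\<close>

lemma power2_powr:
  fixes r :: real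
  assumes "r \<ge> 0"
  shows "(r\<^sup>2) powr k * r = r powr (2 * k + 1)"
proof (cases "r = 0")
  case False
  with assms have "r > 0"
    by simp
  then have "(r\<^sup>2) powr k * r = (r powr 2) powr k * r powr 1"
    by (simp add: powr_numeral)
  also have "\<dots> = r powr (2 * k + 1)"
    by (simp only: powr_powr powr_add)
  finally show ?thesis .
qed simp

text \<open>Here \<open>x * y = u ^ 2 * (1 - r ^ 2) / 4\<close> and \<open>x - y = u * r\<close>.
  The extra \<open>u\<close> is the Jacobian up to the factor 1/2; it adds the last unit to the
  exponent of \<open>u\<close>.\<close>

lemma weight_tri_param:
  assumes "0 \<le> u" "u \<le> 1" "0 \<le> r" "r \<le> 1"
  shows "u * weight \<alpha> \<gamma> \<kappa> (tri_param (u, r)) =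
    (1/4) powr \<alpha> * (u powr (2 * \<alpha> + 2 * \<kappa> + 2) * (1 - u) powr \<gamma>) *
    (r powr (2 * \<kappa> + 1) * (1 - r\<^sup>2) powr \<alpha>)"
proof (cases "u = 0")
  case False
  with assms have u: "u > 0"
    by simp
  have "r\<^sup>2 \<le> 1"
    using assms by (simp add: power_le_one)
  have "weight \<alpha> \<gamma> \<kappa> (tri_param (u, r)) =
      ((1/4) * (u\<^sup>2 * (1 - r\<^sup>2))) powr \<alpha> * (1 - u) powr \<gamma> * (u * r) powr (2 * \<kappa> + 1)"
  proof -
    have "u * (1 + r) / 2 * (u * (1 - r) / 2) = (1/4) * (u\<^sup>2 * (1 - r\<^sup>2))"
      "1 - u * (1 + r) / 2 - u * (1 - r) / 2 = 1 - u"
      "u * (1 + r) / 2 - u * (1 - r) / 2 = u * r"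
      by (simp_all add: power2_eq_square field_simps)
    then show ?thesis
      using assms by (simp only: weight_def tri_param_def prod.case) simp
  qed
  also have "\<dots> = (1/4) powr \<alpha> * ((u\<^sup>2) powr \<alpha> * (1 - r\<^sup>2) powr \<alpha>) * (1 - u) powr \<gamma> *
      (u powr (2 * \<kappa> + 1) * r powr (2 * \<kappa> + 1))"
    using assms \<open>r\<^sup>2 \<le> 1\<close> by (simp only: powr_mult)
  finally have "u * weight \<alpha> \<gamma> \<kappa> (tri_param (u, r)) =
      (1/4) powr \<alpha> * (((u\<^sup>2) powr \<alpha> * u) * u powr (2 * \<kappa> + 1) * (1 - u) powr \<gamma>) *
      (r powr (2 * \<kappa> + 1) * (1 - r\<^sup>2) powr \<alpha>)"
    by (simp add: mult_ac)
  also have "(u\<^sup>2) powr \<alpha> * u * u powr (2 * \<kappa> + 1) = u powr (2 * \<alpha> + 2 * \<kappa> + 2)"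
    unfolding power2_powr[OF \<open>0 \<le> u\<close>] powr_add[symmetric] by (simp add: add_ac)
  finally show ?thesis .
qed simp

lemma sym_mono_tri_param:
  "sym_mono (m, l) (tri_param (u, r)) = (1/4) ^ l * u ^ (m + 2 * l) * (1 - r\<^sup>2) ^ l"
proof -
  have "u * (1 + r) / 2 * (u * (1 - r) / 2) = (1/4) * u\<^sup>2 * (1 - r\<^sup>2)"
    "u * (1 + r) / 2 + u * (1 - r) / 2 = u"
    by (simp_all add: power2_eq_square field_simps)
  then have "sym_mono (m, l) (tri_param (u, r)) = u ^ m * ((1/4) * u\<^sup>2 * (1 - r\<^sup>2)) ^ l"
    by (simp only: sym_mono_def tri_param_def prod.case)
  then show ?thesis
    unfolding power_mult_distrib power_add power_mult[of u 2 l] by (simp only: mult_ac)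
qed

text \<open>For \<open>u > 0\<close> the quotient form \<open>sym_jacobi_eq\<close> applies, and the
  quotient of squares is \<open>r ^ 2\<close>.\<close>

lemma sym_jacobi_tri_param:
  assumes "u > 0"
  shows "sym_jacobi \<alpha> \<gamma> \<kappa> n k (tri_param (u, r)) = sym_jacobi_const \<alpha> \<gamma> \<kappa> n k * u ^ (2 * k) *
    poly (jacobi n (2 * \<alpha> + 2 * \<kappa> + 4 * real k + 2) \<gamma>) (1 - 2 * u) *
    poly (jacobi k \<kappa> \<alpha>) (1 - 2 * r\<^sup>2)"
proof -
  have e: "u * (1 + r) / 2 + u * (1 - r) / 2 = u" "u * (1 + r) / 2 - u * (1 - r) / 2 = u * r"
    "1 - 2 * (u * (1 + r) / 2) - 2 * (u * (1 - r) / 2) = 1 - 2 * u"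
    by (simp_all add: field_simps)
  have "(u * r)\<^sup>2 / u\<^sup>2 = r\<^sup>2"
    using assms by (simp add: power_mult_distrib)
  with e assms show ?thesis
    by (simp only: tri_param_def prod.case sym_jacobi_eq)
qed

lemma
  fixes h :: "real \<Rightarrow> real"
  assumes "set_integrable lborel {0..1} h"
  shows set_integrable_square_subst: "set_integrable lborel {0..1} (\<lambda>r. h (r\<^sup>2) * r)"
    and set_integral_square_subst:
      "(LINT r:{0..1}|lborel. h (r\<^sup>2) * r) = (LINT s:{0..1}|lborel. h s) / 2"
proof -
  have "set_integrable lborel {0\<^sup>2..1\<^sup>2} h"
    using assms by simp
  note * = integral_substitution[of "\<lambda>r. r\<^sup>2" 0 1 h "\<lambda>r. 2 * r", OF this]
  have "set_integrable lborel {0..1} (\<lambda>r. h (r\<^sup>2) * (2 * r))"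
    by (rule *(1)) (auto intro!: derivative_eq_intros continuous_intros)
  then show "set_integrable lborel {0..1} (\<lambda>r. h (r\<^sup>2) * r)"
    by (simp add: mult.left_commute[of _ 2])
  have "(LINT s|lborel. h s * indicator {0\<^sup>2..1\<^sup>2} s) =
      (LINT r|lborel. h (r\<^sup>2) * (2 * r) * indicator {0..1} r)"
    by (rule *(2)) (auto intro!: derivative_eq_intros continuous_intros)
  also have "\<dots> = 2 * (LINT r:{0..1}|lborel. h (r\<^sup>2) * r)"
    unfolding set_lebesgue_integral_def
    by (subst integral_mult_right_zero[symmetric]) (simp add: mult_ac)
  finally show "(LINT r:{0..1}|lborel. h (r\<^sup>2) * r) = (LINT s:{0..1}|lborel. h s) / 2"
    by (simp add: set_lebesgue_integral_def mult.commute)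
qed

text \<open>When \<open>j \<le> i\<close>, the factor \<open>u ^ j\<close> raises the weight
  exponent to the parameter \<open>a + j\<close> of the polynomial, leaving a power of degree
  \<open>i - j < n\<close>. Integrability is obtained from the unshifted weight, so it covers
  \<open>i < j\<close> too.\<close>

lemma
  fixes a b :: real and n :: nat
  assumes ab: "a > -1" "b > -1"
  defines "f \<equiv> \<lambda>i j u. poly (jacobi n (a + real j) b) (1 - 2 * u) * u ^ i * (u powr a * (1 - u) powr b)"
  shows set_integrable_jacobi_radial: "set_integrable lborel {0..1} (f i j)"
    and set_integral_jacobi_radial: "\<lbrakk>j \<le> i; i < j + n\<rbrakk> \<Longrightarrow> (LINT u:{0..1}|lborel. f i j u) = 0"
proof -
  show "set_integrable lborel {0..1} (f i j)"
    using set_integrable_poly_beta[OF ab, of "pcompose (jacobi n (a + real j) b) [:1, -2:] * [:0, 1:] ^ i"]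
    by (simp add: poly_pcompose f_def mult.commute)
  assume i: "j \<le> i" "i < j + n"
  have "(LINT u:{0..1}|lborel. f i j u) = (LINT u:{0..1}|lborel. poly (jacobi n (a + real j) b) (1 - 2 * u) *
      poly (monom 1 (i - j)) u * (u powr (a + real j) * (1 - u) powr b))"
  proof (intro set_lebesgue_integral_cong allI impI)
    fix u :: real
    assume "u \<in> {0..1}"
    then show "f i j u = poly (jacobi n (a + real j) b) (1 - 2 * u) *
        poly (monom 1 (i - j)) u * (u powr (a + real j) * (1 - u) powr b)"
      using i by (simp add: f_def poly_monom power_mult_powr[symmetric] flip: power_add)
  qed simp
  also have "\<dots> = 0"
    using ab i by (intro jacobi_orthogonal) (simp_all add: degree_monom_eq)
  finally show "(LINT u:{0..1}|lborel. f i j u) = 0" .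
qed

text \<open>Under \<open>s = r ^ 2\<close> this becomes the orthogonality of the Jacobi polynomial
  to \<open>(1 - s) ^ l\<close>.\<close>

lemma
  fixes a b :: real and k :: nat
  assumes ab: "a > -1" "b > -1"
  defines "g \<equiv> \<lambda>l r. poly (jacobi k a b) (1 - 2 * r\<^sup>2) * (1 - r\<^sup>2) ^ l *
    (r powr (2 * a + 1) * (1 - r\<^sup>2) powr b)"
  shows set_integrable_jacobi_angular: "set_integrable lborel {0..1} (g l)"
    and set_integral_jacobi_angular: "l < k \<Longrightarrow> (LINT r:{0..1}|lborel. g l r) = 0"
proof -
  let ?h = "\<lambda>s. poly (jacobi k a b) (1 - 2 * s) * (1 - s) ^ l * (s powr a * (1 - s) powr b)"
  have h: "set_integrable lborel {0..1} ?h"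
    using set_integrable_poly_beta[OF ab, of "pcompose (jacobi k a b) [:1, -2:] * [:1, -1:] ^ l"]
    by (simp add: poly_pcompose mult.commute)
  have eq: "g l r = ?h (r\<^sup>2) * r" if "r \<in> {0..1}" for r
    using that by (simp add: g_def flip: power2_powr)
  show "set_integrable lborel {0..1} (g l)"
    by (subst set_integrable_cong[OF refl refl eq]) (use set_integrable_square_subst[OF h] in auto)
  assume "l < k"
  have "(LINT r:{0..1}|lborel. g l r) = (LINT r:{0..1}|lborel. ?h (r\<^sup>2) * r)"
    by (rule set_lebesgue_integral_cong) (use eq in auto)
  also have "\<dots> = 0"
    unfolding set_integral_square_subst[OF h] using ab \<open>l < k\<close> by (simp add: set_integral_jacobi_power)
  finally show "(LINT r:{0..1}|lborel. g l r) = 0" .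
qed

lemma weight_measurable [measurable]: "weight \<alpha> \<gamma> \<kappa> \<in> borel_measurable borel"
proof -
  have [measurable]: "(\<lambda>z::real \<times> real. snd z) \<in> borel_measurable borel"
    by (intro borel_measurable_continuous_onI continuous_intros)
  show ?thesis
    unfolding weight_def split_beta' by measurable
qed

lemma symmetric_polynomial_measurable:
  assumes "symmetric_polynomial p"
  shows "p \<in> borel_measurable borel"
  using assms unfolding symmetric_polynomial_def
  by (intro borel_measurable_continuous_onI continuous_on_polymonial_function)
     (simp add: real_polynomial_function_eq)

lemma sym_jacobi_symmetric_polynomial:
  assumes "\<gamma> > -1" and "\<alpha> + \<kappa> > -3/2"
  shows "symmetric_polynomial (sym_jacobi \<alpha> \<gamma> \<kappa> n k)"
  using symmetric_polynomial_add_scaled[OF lower_comb_symmetric_polynomial[OF sym_jacobi_monic[OF assms]]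
      symmetric_polynomial_sym_mono[of "(n, k)"], of n k 1]
  by simp

lemma
  fixes \<alpha> \<gamma> \<kappa> :: real
  assumes par: "\<alpha> > -1" "\<gamma> > -1" "\<kappa> > -1" "\<alpha> + \<kappa> > -3/2"
  shows set_integrable_sym_jacobi_mono: "set_integrable lborel triangle
      (\<lambda>z. sym_jacobi \<alpha> \<gamma> \<kappa> n k z * sym_mono e z * weight \<alpha> \<gamma> \<kappa> z)" (is ?int)
    and set_integral_sym_jacobi_mono: "e \<prec> (n, k) \<Longrightarrow> (LINT z:triangle|lborel.
      sym_jacobi \<alpha> \<gamma> \<kappa> n k z * sym_mono e z * weight \<alpha> \<gamma> \<kappa> z) = 0" (is "_ \<Longrightarrow> ?eq")
proof -
  obtain m l where e: "e = (m, l)"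
    by (cases e)
  define a where "a = 2 * \<alpha> + 2 * \<kappa> + 2"
  \<comment> \<open>This is exactly the hypothesis on \<open>\<alpha> + \<kappa>\<close>.\<close>
  have a: "a > -1"
    using par by (simp add: a_def)
  \<comment> \<open>The factors come from the normalization, from \<open>(x * y) ^ l\<close>, from
    the weight and from the Jacobian, in this order.\<close>
  define C where "C = sym_jacobi_const \<alpha> \<gamma> \<kappa> n k * (1/4) ^ l * (1/4) powr \<alpha> / 2"
  define F where "F u = poly (jacobi n (a + real (4 * k)) \<gamma>) (1 - 2 * u) * u ^ (2 * k + m + 2 * l) *
    (u powr a * (1 - u) powr \<gamma>)" for u
  define G where "G r = poly (jacobi k \<kappa> \<alpha>) (1 - 2 * r\<^sup>2) * (1 - r\<^sup>2) ^ l *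
    (r powr (2 * \<kappa> + 1) * (1 - r\<^sup>2) powr \<alpha>)" for r
  let ?f = "\<lambda>z. sym_jacobi \<alpha> \<gamma> \<kappa> n k z * sym_mono e z * weight \<alpha> \<gamma> \<kappa> z"
  let ?F = "\<lambda>u. indicator {0..1} u * F u"
  let ?G = "\<lambda>r. indicator {0..1} r * G r"
  have meas: "?f \<in> borel_measurable borel"
    using symmetric_polynomial_measurable[OF sym_jacobi_symmetric_polynomial[OF par(2,4)], of n k]
      symmetric_polynomial_measurable[OF symmetric_polynomial_sym_mono, of e]
    by measurable
  have F: "integrable lborel ?F"
    using set_integrable_jacobi_radial[OF a par(2), of n "4 * k" "2 * k + m + 2 * l"]
    by (simp add: set_integrable_def F_def[abs_def])
  have G: "integrable lborel ?G"
    using set_integrable_jacobi_angular[OF par(3,1), of k l]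
    by (simp add: set_integrable_def G_def[abs_def])
  have eq: "indicator unit_square z *\<^sub>R (fst z / 2 * ?f (tri_param z)) = C * (?F (fst z) * ?G (snd z))" for z
  proof (cases "z \<in> unit_square")
    case True
    then obtain u r where z: "z = (u, r)" and ur: "0 < u" "u \<le> 1" "0 < r" "r \<le> 1"
      by (auto simp: unit_square_def)
    have "fst z / 2 * ?f (tri_param z) = sym_jacobi \<alpha> \<gamma> \<kappa> n k (tri_param (u, r)) *
        sym_mono (m, l) (tri_param (u, r)) * (u * weight \<alpha> \<gamma> \<kappa> (tri_param (u, r))) / 2"
      by (simp add: z e)
    also have "\<dots> = C * (F u * G r)"
      using ur by (subst weight_tri_param)
        (simp_all add: sym_jacobi_tri_param sym_mono_tri_param F_def G_def C_def a_def power_add add_ac mult_ac)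
    finally show ?thesis
      using True ur by (simp add: z)
  next
    \<comment> \<open>The closed unit square exceeds \<open>unit_square\<close> only where
      \<open>u = 0\<close> or \<open>r = 0\<close>; there \<open>F\<close> or \<open>G\<close>
      vanishes because \<open>0 powr a = 0\<close>.\<close>
    case False
    then have "fst z \<notin> {0..1} \<or> snd z \<notin> {0..1} \<or> fst z = 0 \<or> snd z = 0"
      by (cases z) (auto simp: unit_square_def)
    then show ?thesis
      using False by (auto simp: F_def G_def)
  qed
  show ?int
    unfolding set_integrable_triangle_iff[OF meas] set_integrable_def[of _ unit_square] eq
    by (intro integrable_mult_right integrable_lborel_prod_mult F G)
  assume ord: "e \<prec> (n, k)"
  have "(LINT u:{0..1}|lborel. F u) = 0 \<or> (LINT r:{0..1}|lborel. G r) = 0"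
  proof (cases "l < k")
    case True
    then show ?thesis
      using set_integral_jacobi_angular[OF par(3,1)] by (simp add: G_def)
  next
    \<comment> \<open>With \<open>l \<ge> k\<close> a tie in weighted degree is excluded, so
      \<open>m + 2 * l < n + 2 * k\<close>; both bounds on the exponent of \<open>u\<close>
      follow.\<close>
    case False
    then have "4 * k \<le> 2 * k + m + 2 * l" "2 * k + m + 2 * l < 4 * k + n"
      using ord by (auto simp: e sym_less_def)
    then show ?thesis
      unfolding F_def by (intro disjI1 set_integral_jacobi_radial a par(2))
  qed
  then have "integral\<^sup>L lborel ?F * integral\<^sup>L lborel ?G = 0"
    by (auto simp: set_lebesgue_integral_def)
  then show ?eq
    unfolding set_integral_triangle[OF meas] set_lebesgue_integral_def[of _ unit_square] eq
    by (simp add: integral_lborel_prod_mult[OF F G])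
qed

subsection \<open>Uniqueness\<close>

text \<open>Restriction to the line through \<open>x\<close> and \<open>z\<close> reduces the claim to polynomials in one variable.\<close>

lemma real_polynomial_function_zero_open:
  fixes f :: "'a::real_normed_vector \<Rightarrow> real"
  assumes f: "real_polynomial_function f" and "open S" "x \<in> S" and zero: "\<And>y. y \<in> S \<Longrightarrow> f y = 0"
  shows "f z = 0"
proof -
  define l where "l t = x + t *\<^sub>R (z - x)" for t :: real
  have lin: "bounded_linear (\<lambda>t::real. t *\<^sub>R (z - x))"
    by (rule bounded_linear_scaleR_left)
  have "polynomial_function l"
    unfolding l_def by (intro polynomial_function_add polynomial_function_const polynomial_function_bounded_linear lin)
  then have "real_polynomial_function (f \<circ> l)"
    using f by (rule real_polynomial_function_compose)
  then obtain a N where fl: "f (l t) = (\<Sum>i\<le>N. a i * t ^ i)" for t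
    unfolding real_polynomial_function_iff_sum by (auto simp: fun_eq_iff)
  have "continuous_on UNIV l"
    unfolding l_def by (intro continuous_intros)
  then have "open (l -` S)"
    using \<open>open S\<close> by (simp add: continuous_on_open_vimage)
  moreover have "0 \<in> l -` S"
    using \<open>x \<in> S\<close> by (simp add: l_def)
  ultimately obtain e where e: "e > 0" "ball 0 e \<subseteq> l -` S"
    by (meson open_contains_ball)
  have "infinite (ball (0::real) e)"
    using e(1) by (simp add: ball_eq_greaterThanLessThan)
  moreover have "ball 0 e \<subseteq> {t. (\<Sum>i\<le>N. a i * t ^ i) = 0}"
    using e(2) zero by (auto simp flip: fl)
  ultimately have "infinite {t. (\<Sum>i\<le>N. a i * t ^ i) = 0}"
    using finite_subset by blast
  then have "\<forall>i\<le>N. a i = 0"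
    using polyfun_finite_roots[of a N] by blast
  then have "f (l 1) = 0"
    by (simp add: fl)
  then show ?thesis
    by (simp add: l_def)
qed

lemma sym_less_linear: "d = e \<or> d \<prec> e \<or> e \<prec> (d :: nat \<times> nat)"
  by (cases d; cases e) (auto simp: sym_less_def)

lemma sym_less_trans: "d \<prec> e \<Longrightarrow> e \<prec> f \<Longrightarrow> d \<prec> (f :: nat \<times> nat)"
  by (cases d; cases e; cases f) (auto simp: sym_less_def)

lemma finite_sym_less_max:
  fixes S :: "(nat \<times> nat) set"
  assumes "finite S" "S \<noteq> {}"
  shows "\<exists>d\<in>S. \<forall>e\<in>S. e = d \<or> e \<prec> d"
  using assms
proof (induction rule: finite_ne_induct)
  case (insert x F)
  then obtain d where "d \<in> F" "\<forall>e\<in>F. e = d \<or> e \<prec> d"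
    by auto
  then show ?case
    using sym_less_linear[of x d] sym_less_trans by (metis insert_iff)
qed simp

text \<open>A nonzero value forces a nonempty finite support, and its largest index is a symmetric
  degree.\<close>

lemma lower_comb_has_sym_degree:
  fixes d :: "nat \<times> nat"
  assumes "lower_comb d q" "q z \<noteq> 0"
  shows "\<exists>e. has_sym_degree q e \<and> e \<prec> d"
proof -
  obtain c where c: "finite {e. c e \<noteq> 0}" "\<And>e. c e \<noteq> 0 \<Longrightarrow> e \<prec> d" "\<And>z. q z = sym_lincomb c z"
    using assms(1) unfolding lower_comb_def by auto
  have "{e. c e \<noteq> 0} \<noteq> {}"
    using assms(2) unfolding c(3) sym_lincomb_def by (metis sum.empty)
  then obtain e where "c e \<noteq> 0" "\<forall>e'. c e' \<noteq> 0 \<longrightarrow> e' = e \<or> e' \<prec> e"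
    using finite_sym_less_max[OF c(1)] by auto
  then show ?thesis
    using c unfolding has_sym_degree_def by metis
qed

lemma is_monic_sym_orth_iff:
  "is_monic_sym_orth \<alpha> \<gamma> \<kappa> n k p \<longleftrightarrow>
     symmetric_polynomial p \<and> lower_comb (n, k) (\<lambda>z. p z - sym_mono (n, k) z) \<and>
     (\<forall>q d. symmetric_polynomial q \<and> has_sym_degree q d \<and> d \<prec> (n, k) \<longrightarrow>
        set_integrable lborel triangle (\<lambda>z. p z * q z * weight \<alpha> \<gamma> \<kappa> z) \<and>
        set_lebesgue_integral lborel triangle (\<lambda>z. p z * q z * weight \<alpha> \<gamma> \<kappa> z) = 0)"
  by (simp add: is_monic_sym_orth_def lower_comb_def algebra_simps)

lemma weight_nonneg: "weight \<alpha> \<gamma> \<kappa> z \<ge> 0"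
  by (cases z) (simp add: weight_def)

text \<open>The leading monomials cancel in \<open>q = p - p'\<close>, so \<open>q\<close> is an
  admissible test polynomial for both, and \<open>q ^ 2\<close> has weighted integral 0. Positivity
  of the weight inside the triangle and continuity make \<open>q\<close> vanish there, hence
  everywhere.\<close>

lemma is_monic_sym_orth_unique:
  assumes p: "is_monic_sym_orth \<alpha> \<gamma> \<kappa> n k p" and p': "is_monic_sym_orth \<alpha> \<gamma> \<kappa> n k p'"
  shows "p = p'"
proof (rule ccontr)
  assume "p \<noteq> p'"
  define q where "q z = p z - p' z" for z
  obtain z0 where "q z0 \<noteq> 0"
    using \<open>p \<noteq> p'\<close> unfolding q_def by (metis eq_iff_diff_eq_0 ext)
  have "lower_comb (n, k) q"
    using lower_comb_add_scaled[of "(n, k)" "\<lambda>z. p z - sym_mono (n, k) z" "\<lambda>z. p' z - sym_mono (n, k) z" "-1"] p p'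
    by (simp add: is_monic_sym_orth_iff q_def[abs_def])
  then obtain e where e: "has_sym_degree q e" "e \<prec> (n, k)"
    using lower_comb_has_sym_degree \<open>q z0 \<noteq> 0\<close> by blast
  have sym: "symmetric_polynomial q"
    using \<open>lower_comb (n, k) q\<close> by (rule lower_comb_symmetric_polynomial)
  let ?w = "weight \<alpha> \<gamma> \<kappa>"
  have int: "set_integrable lborel triangle (\<lambda>z. p z * q z * ?w z)"
      "set_integrable lborel triangle (\<lambda>z. p' z * q z * ?w z)"
    and zero: "(LINT z:triangle|lborel. p z * q z * ?w z) = 0"
      "(LINT z:triangle|lborel. p' z * q z * ?w z) = 0"
    using p p' sym e unfolding is_monic_sym_orth_iff by blast+
  have eq: "p z * q z * ?w z - p' z * q z * ?w z = (q z)\<^sup>2 * ?w z" for z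
    by (simp add: q_def power2_eq_square algebra_simps)
  have "set_integrable lborel triangle (\<lambda>z. (q z)\<^sup>2 * ?w z)"
    using set_integral_diff(1)[OF int] by (simp add: eq)
  then have int2: "integrable lborel (\<lambda>z. indicator triangle z * ((q z)\<^sup>2 * ?w z))"
    by (simp add: set_integrable_def)
  have "(LINT z:triangle|lborel. (q z)\<^sup>2 * ?w z) = 0"
    using set_integral_diff(2)[OF int] by (simp add: eq zero)
  then have zero2: "(LINT z|lborel. indicator triangle z * ((q z)\<^sup>2 * ?w z)) = 0"
    by (simp add: set_lebesgue_integral_def)
  have "AE z in lborel. indicator triangle z * ((q z)\<^sup>2 * ?w z) = 0"
    using integral_nonneg_eq_0_iff_AE[OF int2] zero2
    by (simp add: weight_nonneg)
  \<comment> \<open>Restricting to the open interior makes the weight strictly positive and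
    \<open>U\<close> open; an open null set is empty.\<close>
  define U :: "(real \<times> real) set" where
    "U = {z. 0 < snd z} \<inter> {z. snd z < fst z} \<inter> {z. fst z + snd z < 1} \<inter> {z. q z \<noteq> 0}"
  have cont: "continuous_on UNIV q"
    using sym unfolding symmetric_polynomial_def
    by (intro continuous_on_polymonial_function) (simp add: real_polynomial_function_eq)
  have "open U"
    unfolding U_def using cont
    by (intro open_Int open_Collect_less open_Collect_neq continuous_intros)
  have "AE z in lborel. z \<notin> U"
    using \<open>AE z in lborel. indicator triangle z * ((q z)\<^sup>2 * ?w z) = 0\<close>
  proof eventually_elim
    case (elim z)
    show "z \<notin> U"
    proof
      assume "z \<in> U"
      then have "z \<in> triangle" "q z \<noteq> 0" "?w z > 0"
        by (cases z; auto simp: U_def triangle_def T2_def weight_def)+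
      with elim show False
        by simp
    qed
  qed
  then have "U \<in> null_sets lborel"
    using \<open>open U\<close> by (subst AE_iff_null_sets) auto
  then have "negligible U"
    by (simp add: negligible_iff_null_sets null_sets_completionI)
  then have "U = {}"
    using \<open>open U\<close> open_not_negligible by blast
  show False
  proof -
    let ?V = "{z::real\<times>real. 0 < snd z} \<inter> {z. snd z < fst z} \<inter> {z. fst z + snd z < 1}"
    have "open ?V"
      by (intro open_Int open_Collect_less continuous_intros)
    moreover have "(1/2, 1/4) \<in> ?V"
      by simp
    moreover have "q z = 0" if "z \<in> ?V" for z
      using that \<open>U = {}\<close> by (auto simp: U_def)
    ultimately have "q z0 = 0"
      using sym unfolding symmetric_polynomial_def by (blast intro: real_polynomial_function_zero_open)
    with \<open>q z0 \<noteq> 0\<close> show False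
      by simp
  qed
qed

section \<open>Existence and conclusion\<close>

lemma is_monic_sym_orth_sym_jacobi:
  assumes "\<alpha> > -1" and "\<gamma> > -1" and "\<kappa> > -1" and "\<alpha> + \<kappa> > -3/2"
  shows "is_monic_sym_orth \<alpha> \<gamma> \<kappa> n k (sym_jacobi \<alpha> \<gamma> \<kappa> n k)"
  unfolding is_monic_sym_orth_iff
proof (intro conjI allI impI)
  show "symmetric_polynomial (sym_jacobi \<alpha> \<gamma> \<kappa> n k)"
    using assms by (intro sym_jacobi_symmetric_polynomial)
  show "lower_comb (n, k) (\<lambda>z. sym_jacobi \<alpha> \<gamma> \<kappa> n k z - sym_mono (n, k) z)"
    using assms by (intro sym_jacobi_monic)
  fix q and d :: "nat \<times> nat"
  assume q: "symmetric_polynomial q \<and> has_sym_degree q d \<and> d \<prec> (n, k)"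
  then obtain c where c: "\<And>z. q z = sym_lincomb c z" "\<And>e. c e \<noteq> 0 \<Longrightarrow> e = d \<or> e \<prec> d"
    unfolding has_sym_degree_def by auto
  let ?f = "\<lambda>e z. c e * (sym_jacobi \<alpha> \<gamma> \<kappa> n k z * sym_mono e z * weight \<alpha> \<gamma> \<kappa> z)"
  have eq: "sym_jacobi \<alpha> \<gamma> \<kappa> n k z * q z * weight \<alpha> \<gamma> \<kappa> z = (\<Sum>e | c e \<noteq> 0. ?f e z)" for z
    by (simp add: c(1) sym_lincomb_def sum_distrib_left sum_distrib_right mult_ac)
  have int: "set_integrable lborel triangle (?f e)" for e
    using set_integrable_sym_jacobi_mono[OF assms] by simp
  show "set_integrable lborel triangle (\<lambda>z. sym_jacobi \<alpha> \<gamma> \<kappa> n k z * q z * weight \<alpha> \<gamma> \<kappa> z)"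
    unfolding eq by (rule set_integrable_sum) (rule int)
  \<comment> \<open>Linearity reduces the claim to monomials, and transitivity puts each of them
    below \<open>(n, k)\<close>.\<close>
  have "e \<prec> (n, k)" if "c e \<noteq> 0" for e
    using c(2)[OF that] q sym_less_trans by blast
  then show "(LINT z:triangle|lborel. sym_jacobi \<alpha> \<gamma> \<kappa> n k z * q z * weight \<alpha> \<gamma> \<kappa> z) = 0"
    unfolding eq using int set_integral_sym_jacobi_mono[OF assms]
    by (subst set_integral_sum) simp_all
qed

text \<open>\<open>monic_sym_orth\<close> is a definite description, meaningful only when exactly
  one candidate exists; hence the first conjunct.\<close>

theorem proposition6p3:
  fixes \<alpha> \<gamma> \<kappa> :: real and n k :: nat
  assumes "\<alpha> > -1" and "\<gamma> > -1" and "\<kappa> > -1" and "\<alpha> + \<kappa> > -3/2"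
  shows "(\<exists>!p. is_monic_sym_orth \<alpha> \<gamma> \<kappa> n k p) \<and>
         sym_jacobi \<alpha> \<gamma> \<kappa> n k = monic_sym_orth \<alpha> \<gamma> \<kappa> n k"
  unfolding monic_sym_orth_def
  using is_monic_sym_orth_sym_jacobi[OF assms] is_monic_sym_orth_unique
  by (metis the_equality)

end
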